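(* Consider the case without line thermal limits, as described in the context, and assume Assumptions 1 and 2 hold. Then along every trajectory of the DPPD dynamics (without line limits), $$\liminf_{t\to\infty}\big(\|\dot d\|+\|\dot\eta\|+\|\dot{\hat\theta}\|+\|\dot P\|+\|\dot\mu\|+\|\dot\omega\|\big)=O(1/\sqrt t),$$ i.e. $\liminf_{t\to\infty}\sqrt t\,\big(\|\dot d\|+\|\dot\eta\|+\|\dot{\hat\theta}\|+\|\dot P\|+\|\dot\mu\|+\|\dot\omega\|\big)<\infty$.
   Context: Power network: a directed connected graph $\mathcal G(\mathcal N,\mathcal E)$ with buses $\mathcal N=\{1,\dots,n\}$ and lines $\mathcal E\subseteq\mathcal N\times\mathcal N$. Each line $ij$ has susceptance $B_{ij}>0$; each bus has damping $D_i>0$ and a given constant power injection $P_i^{in}\in\mathbb R$. For $x\in\mathbb R^n$ write $x_{ij}=x_i-x_j$. $\|\cdot\|$ is the Euclidean norm. Costs: $f_i=f_{i,0}+f_{i,1}+f_{i,2}$, where $f_{i,0}:\mathbb R\to\mathbb R$ is differentiable, $f_{i,1}$ is the indicator function of $\Omega_i=[\underline d_i,\overline d_i]$, and $f_{i,2}:\mathbb R\to\mathbb R$ is lower semicontinuous convex; $\Omega=\Omega_1\times\dots\times\Omega_n$. Assumption 1: each $f_{i,0}$ is $\beta$-strongly convex with $\beta>1$. Assumption 2 (Slater): there exist $\tilde d\in\mathrm{relint}(\Omega)$ and $\tilde\theta\in\mathbb R^n$ with $0=P_i^{in}-\tilde d_i+\sum_{k:ki\in\mathcal E}B_{ki}\tilde\theta_{ki}-\sum_{j:ij\in\mathcal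 E}B_{ij}\tilde\theta_{ij}$ for all $i$ and $\underline P_{ij}<B_{ij}\tilde\theta_{ij}<\overline P_{ij}$ for all $ij\in\mathcal E$ (for given line limits $\underline P_{ij}\le\overline P_{ij}$). Proximal operator: $\mathbf{prox}_{g}(y)=\arg\min_x\{g(x)+\tfrac12\|x-y\|^2\}$. DPPD dynamics without line limits (fixed constant $\kappa\in(0,1)$): with $u_{i,1}=P_i^{in}-d_i-D_i\omega_i+\sum_{k:ki\in\mathcal E}P_{ki}-\sum_{j:ij\in\mathcal E}P_{ij}$ and $u_{i,2}=P_i^{in}-d_i+\sum_{k:ki\in\mathcal E}B_{ki}\hat\theta_{ki}-\sum_{j:ij\in\mathcal E}B_{ij}\hat\theta_{ij}$: $\dot\eta_i=\mathbf{prox}_{f_{i,2}}(d_i-\kappa\eta_i)-d_i$; $\dot d_i=\mathbf{prox}_{f_{i,1}}\big(d_i-\nabla f_{i,0}(d_i)+\kappa\eta_i+\lambda_i+u_{i,1}+\mu_i+u_{i,2}\big)-d_i$; $\omega_i=\lambda_i$; $\dot{\hat\theta}_i=\sum_{j:ij\in\mathcal E}B_{ij}(\mu_i+u_{i,2}-\mu_j-u_{j,2})-\sum_{k:ki\in\mathcal E}B_{ki}(\mu_k+u_{k,2}-\mu_i-u_{i,2})$; $\dot P_{ij}=\lambda_i+u_{i,1}-\lambda_j-u_{j,1}$; $\dot\lambda_i=\tfrac12u_{i,1}$; $\dot\mu_i=\tfrac12u_{i,2}$. Vectors $d,\eta,\hat\theta,\mu,\omega\in\mathbb R^n$, $P\in\mathbb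 R^{|\mathcal E|}$ stack the corresponding components. *)

theory Defs
  imports "HOL-Analysis.Analysis"
begin

text \<open>Strong convexity with modulus beta (for functions real to real).\<close>
definition strongly_convex :: "real \<Rightarrow> (real \<Rightarrow> real) \<Rightarrow> bool" where
  "strongly_convex \<beta> f \<longleftrightarrow> convex_on UNIV (\<lambda>x. f x - \<beta> / 2 * x\<^sup>2)"

text \<open>Lower semicontinuity of a real function (everywhere).\<close>
definition lsc :: "(real \<Rightarrow> real) \<Rightarrow> bool" where
  "lsc f \<longleftrightarrow> (\<forall>x c. c < f x \<longrightarrow> (\<forall>\<^sub>F y in at x. c < f y))"

text \<open>Proximal operator of an extended-real valued function g:
  prox g y = argmin_x ( g x + (x - y)^2 / 2 ).\<close>
definition prox :: "(real \<Rightarrow> ereal) \<Rightarrow> real \<Rightarrow> real" where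
  "prox g y = (SOME x. \<forall>z. g x + ereal ((x - y)\<^sup>2 / 2) \<le> g z + ereal ((z - y)\<^sup>2 / 2))"

text \<open>Indicator function (in the sense of convex analysis) of a set.\<close>
definition ind :: "real set \<Rightarrow> real \<Rightarrow> ereal" where
  "ind S x = (if x \<in> S then 0 else \<infinity>)"

text \<open>Euclidean norm of a vector indexed by a finite set I.\<close>
definition vnorm :: "'a set \<Rightarrow> ('a \<Rightarrow> real) \<Rightarrow> real" where
  "vnorm I x = sqrt (\<Sum>i\<in>I. (x i)\<^sup>2)"

text \<open>Weak connectivity of the directed graph (N = UNIV of a finite type).\<close>
definition graph_connected :: "('n \<times> 'n) set \<Rightarrow> bool" where
  "graph_connected E \<longleftrightarrow> (\<forall>i j. (i, j) \<in> (E \<union> E\<inverse>)\<^sup>*)"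

text \<open>u_{i,1}\<close>
definition u1 :: "('n \<times> 'n) set \<Rightarrow> ('n \<Rightarrow> real) \<Rightarrow> ('n \<Rightarrow> real) \<Rightarrow> ('n \<Rightarrow> real)
   \<Rightarrow> ('n \<Rightarrow> real) \<Rightarrow> ('n \<times> 'n \<Rightarrow> real) \<Rightarrow> 'n \<Rightarrow> real" where
  "u1 E Pin D d \<omega> P i = Pin i - d i - D i * \<omega> i
      + (\<Sum>k\<in>{k. (k, i) \<in> E}. P (k, i)) - (\<Sum>j\<in>{j. (i, j) \<in> E}. P (i, j))"

text \<open>u_{i,2}\<close>
definition u2 :: "('n \<times> 'n) set \<Rightarrow> ('n \<times> 'n \<Rightarrow> real) \<Rightarrow> ('n \<Rightarrow> real) \<Rightarrow> ('n \<Rightarrow> real)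
   \<Rightarrow> ('n \<Rightarrow> real) \<Rightarrow> 'n \<Rightarrow> real" where
  "u2 E B Pin d \<theta> i = Pin i - d i
      + (\<Sum>k\<in>{k. (k, i) \<in> E}. B (k, i) * (\<theta> k - \<theta> i))
      - (\<Sum>j\<in>{j. (i, j) \<in> E}. B (i, j) * (\<theta> i - \<theta> j))"

end

theory Submission
  imports Defs
begin

text \<open>
  An equilibrium has \<open>\<lambda> = 0\<close>, \<open>\<mu>\<close> equal to a common scalar \<open>\<nu>\<close>, and \<open>d\<close> an optimal dispatch. Since the
  minimiser of \<open>f\<^sub>i(x) - \<nu> x\<close> over \<open>\<Omega>\<^sub>i\<close> is a Lipschitz function of \<open>\<nu>\<close> that reaches both endpoints, the
  intermediate value theorem yields a multiplier \<open>\<nu>\<close> that balances the network; the phase angles exist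
  because the Laplacian of a connected graph is onto the zero-sum vectors.

  Write \<open>x\<^sup>~\<close> for the deviation from this equilibrium, \<open>a = \<lambda> + u\<^sub>1\<close> and \<open>b = \<mu>\<^sup>~ + u\<^sub>2\<close>. The function
  \<open>V = |d\<^sup>~|\<^sup>2/2 + \<kappa>|\<eta>\<^sup>~|\<^sup>2/2 - \<kappa> \<eta>\<^sup>~ d\<^sup>~ + Bregman(f\<^sub>0) + (|\<lambda>|\<^sup>2 + |a|\<^sup>2 + 3 \<lambda>D\<lambda> + |P\<^sup>~|\<^sup>2 + |\<theta>\<^sup>~|\<^sup>2 + |\<mu>\<^sup>~|\<^sup>2 + |b|\<^sup>2)/2\<close>
  is nonnegative, and the variational inequalities of the two proximal maps give
  \<open>V' \<le> - c (|d'|\<^sup>2 + |\<eta>'|\<^sup>2 + |\<theta>'|\<^sup>2 + |P'|\<^sup>2 + |\<mu>'|\<^sup>2 + |\<omega>'|\<^sup>2)\<close> with \<open>c = 1 - ((1 + \<kappa>)/2)\<^sup>2\<close>: the indefinite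
  term \<open>(1 + \<kappa>) \<eta>' d\<^sup>~\<close> is absorbed by \<open>|\<eta>'|\<^sup>2\<close> and \<open>\<beta> |d\<^sup>~|\<^sup>2\<close>, which is where \<open>\<beta> > 1\<close> enters. If the speed
  stayed above \<open>1 / sqrt t\<close>, then \<open>V\<close> would decrease at least logarithmically and become negative.
\<close>

section \<open>Proximal maps and strong convexity\<close>

lemma subgradient_exists:
  fixes f :: "real \<Rightarrow> real"
  assumes "convex_on UNIV f"
  obtains s where "\<And>z. f x + s * (z - x) \<le> f z"
  using convex_le_Inf_differential[OF assms, of x] that by (metis UNIV_I interior_UNIV)

text \<open>Compare \<open>q\<close> with points on the segment towards \<open>z\<close>: convexity
  bounds the change of \<open>f\<close> linearly in the step \<open>s\<close>; dividing by
  \<open>s\<close> and letting it tend to 0 from the right leaves the derivative of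
  \<open>g\<close>.\<close>

lemma minimizer_variational_ineq:
  fixes f g :: "real \<Rightarrow> real"
  assumes f: "convex_on S f" and g: "(g has_real_derivative g') (at q)"
    and q: "q \<in> S" and min: "\<And>z. z \<in> S \<Longrightarrow> f q + g q \<le> f z + g z"
    and z: "z \<in> S"
  shows "- g' * (z - q) \<le> f z - f q"
proof -
  have "((\<lambda>s. g (q + s * (z - q))) has_real_derivative g' * (z - q)) (at 0)"
    by (rule DERIV_chain2[of g]) (auto intro!: derivative_eq_intros g)
  then have lim: "((\<lambda>s. (g (q + s * (z - q)) - g q) / s) \<longlongrightarrow> g' * (z - q)) (at_right 0)"
    by (auto simp: has_field_derivative_iff intro: tendsto_within_subset)
  have "\<forall>\<^sub>F s in at_right (0::real). - (f z - f q) \<le> (g (q + s * (z - q)) - g q) / s"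
    using eventually_at_right_real[OF zero_less_one]
  proof eventually_elim
    case (elim s)
    let ?w = "(1 - s) * q + s * z"
    have w: "?w = q + s * (z - q)" by (simp add: algebra_simps)
    have "?w \<in> S"
      using convex_on_imp_convex[OF f] q z elim by (auto simp: convex_alt)
    moreover have "f ?w \<le> (1 - s) * f q + s * f z"
      using convex_onD[OF f, of s q z] q z elim by simp
    ultimately have "f q + g q \<le> (1 - s) * f q + s * f z + g ?w"
      using min[of ?w] by linarith
    then have "- (f z - f q) * s \<le> g ?w - g q" by (simp add: algebra_simps)
    then show ?case using elim by (simp add: w pos_le_divide_eq)
  qed
  from tendsto_lowerbound[OF lim this] show ?thesis by simp
qed

lemma has_derivative_half_square_diff:
  "((\<lambda>x. (x - y)\<^sup>2 / 2) has_real_derivative q - y) (at q)"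
  by (auto intro!: derivative_eq_intros)

text \<open>A subgradient at \<open>y\<close> bounds \<open>f\<close> below by an affine function,
  which the square outweighs at distance at least \<open>2 * |s|\<close> from \<open>y\<close>; a
  minimiser on that compact interval is therefore global.\<close>

lemma convex_plus_square_attains_min:
  fixes f :: "real \<Rightarrow> real"
  assumes f: "convex_on UNIV f"
  obtains q where "\<And>z. f q + (q - y)\<^sup>2 / 2 \<le> f z + (z - y)\<^sup>2 / 2"
proof -
  obtain s where s: "\<And>z. f y + s * (z - y) \<le> f z" using subgradient_exists[OF f] by blast
  let ?F = "\<lambda>z. f z + (z - y)\<^sup>2 / 2" and ?I = "{y - 2 * \<bar>s\<bar>..y + 2 * \<bar>s\<bar>}"
  have "continuous_on ?I ?F"
    by (intro continuous_intros continuous_on_subset[OF convex_on_continuous[OF open_UNIV f]]) auto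
  then obtain q where q: "q \<in> ?I" "\<And>z. z \<in> ?I \<Longrightarrow> ?F q \<le> ?F z"
    using continuous_attains_inf[of ?I ?F] by (auto simp: Ball_def)
  have "?F q \<le> ?F z" for z
  proof (cases "z \<in> ?I")
    case False
    then have "2 * \<bar>s\<bar> \<le> \<bar>z - y\<bar>" by auto
    then have "2 * \<bar>s\<bar> * \<bar>z - y\<bar> \<le> (z - y)\<^sup>2"
      using mult_right_mono[of "2 * \<bar>s\<bar>" "\<bar>z - y\<bar>" "\<bar>z - y\<bar>"] by (simp add: power2_eq_square)
    moreover have "- (\<bar>s\<bar> * \<bar>z - y\<bar>) \<le> s * (z - y)"
      by (metis abs_ge_minus_self abs_mult minus_le_iff)
    ultimately have "?F y \<le> ?F z" using s[of z] by simp
    with q(2)[of y] show ?thesis by simp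
  qed (use q in auto)
  then show ?thesis using that by blast
qed

text \<open>The minimiser exists, so the choice in \<open>prox\<close> is genuine; the slope
  \<open>q - y\<close> of the square makes the residual \<open>y - q\<close> a subgradient of
  \<open>f\<close> at the proximal point \<open>q\<close>.\<close>

lemma prox_real_variational_ineq:
  assumes f: "convex_on UNIV f"
  shows "(y - prox (\<lambda>x. ereal (f x)) y) * (z - prox (\<lambda>x. ereal (f x)) y)
    \<le> f z - f (prox (\<lambda>x. ereal (f x)) y)"
proof -
  let ?q = "prox (\<lambda>x. ereal (f x)) y"
  have "\<exists>q. \<forall>z. ereal (f q) + ereal ((q - y)\<^sup>2 / 2) \<le> ereal (f z) + ereal ((z - y)\<^sup>2 / 2)"
    using convex_plus_square_attains_min[OF f, of y] by (metis ereal_less_eq(3) plus_ereal.simps(1))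
  from someI_ex[OF this] have "f ?q + (?q - y)\<^sup>2 / 2 \<le> f z + (z - y)\<^sup>2 / 2" for z
    by (simp add: prox_def)
  from minimizer_variational_ineq[OF f has_derivative_half_square_diff _ this, of z]
  show ?thesis by simp
qed

text \<open>The prox of an indicator is the projection; the second claim is its obtuse-angle
  property, the variational inequality with zero convex part.\<close>

lemma prox_ind_variational_ineq:
  assumes ne: "lo \<le> hi"
  shows "prox (ind {lo..hi}) y \<in> {lo..hi}"
    and "z \<in> {lo..hi} \<Longrightarrow> (y - prox (ind {lo..hi}) y) * (z - prox (ind {lo..hi}) y) \<le> 0"
proof -
  let ?p = "prox (ind {lo..hi}) y"
  have "continuous_on {lo..hi} (\<lambda>x. (x - y)\<^sup>2 / 2)" by (intro continuous_intros) auto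
  then obtain q where "q \<in> {lo..hi}" "\<And>z. z \<in> {lo..hi} \<Longrightarrow> (q - y)\<^sup>2 / 2 \<le> (z - y)\<^sup>2 / 2"
    using continuous_attains_inf[of "{lo..hi}" "\<lambda>x. (x - y)\<^sup>2 / 2"] ne by (auto simp: Ball_def)
  then have "\<forall>z. ind {lo..hi} q + ereal ((q - y)\<^sup>2 / 2) \<le> ind {lo..hi} z + ereal ((z - y)\<^sup>2 / 2)"
    by (auto simp: ind_def)
  from someI[of "\<lambda>q. \<forall>z. ind {lo..hi} q + ereal ((q - y)\<^sup>2 / 2)
      \<le> ind {lo..hi} z + ereal ((z - y)\<^sup>2 / 2)", OF this]
  have p: "ind {lo..hi} ?p + ereal ((?p - y)\<^sup>2 / 2) \<le> ind {lo..hi} z + ereal ((z - y)\<^sup>2 / 2)" for z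
    by (simp add: prox_def)
  \<comment> \<open>Testing against the finite value at \<open>lo\<close> excludes an infinite
    minimum.\<close>
  from p[of lo] show mem: "?p \<in> {lo..hi}" using ne by (auto simp: ind_def split: if_splits)
  have "0 + (?p - y)\<^sup>2 / 2 \<le> 0 + (z - y)\<^sup>2 / 2" if "z \<in> {lo..hi}" for z
    using p[of z] mem that by (auto simp: ind_def)
  from minimizer_variational_ineq[OF _ has_derivative_half_square_diff mem this, of z]
  show "z \<in> {lo..hi} \<Longrightarrow> (y - ?p) * (z - ?p) \<le> 0"
    by (simp add: convex_on_const)
qed

lemma strongly_convex_above_tangent:
  assumes "strongly_convex \<beta> f" and "f differentiable (at x)"
  shows "f x + deriv f x * (z - x) + \<beta> / 2 * (z - x)\<^sup>2 \<le> f z"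
proof -
  have f: "(f has_real_derivative deriv f x) (at x)"
    using assms(2) by (simp add: DERIV_deriv_iff_real_differentiable)
  have "((\<lambda>x. f x - \<beta> / 2 * x\<^sup>2) has_real_derivative deriv f x - \<beta> * x) (at x)"
    by (auto intro!: derivative_eq_intros f)
  then have "(deriv f x - \<beta> * x) * (z - x) \<le> (f z - \<beta> / 2 * z\<^sup>2) - (f x - \<beta> / 2 * x\<^sup>2)"
    using assms(1) by (intro convex_on_imp_above_tangent[where A = UNIV]) (auto simp: strongly_convex_def)
  then show ?thesis by (simp add: power2_eq_square field_simps)
qed

lemma strongly_convex_deriv_strongly_mono:
  assumes "strongly_convex \<beta> f" and "f differentiable (at x)" "f differentiable (at y)"
  shows "\<beta> * (x - y)\<^sup>2 \<le> (deriv f x - deriv f y) * (x - y)"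
  using strongly_convex_above_tangent[OF assms(1,2), of y]
    strongly_convex_above_tangent[OF assms(1,3), of x]
  by (simp add: power2_eq_square field_simps)

section \<open>Optimal dispatch\<close>

text \<open>One-dimensional replacement for the subdifferential sum rule. At a global minimiser the
  slope 0 works. Otherwise a better point \<open>y\<close> lies outside the interval, which stays on
  the other side of \<open>x\<close>, so any subgradient at \<open>x\<close> has the required sign
  there.\<close>

lemma constrained_min_subgradient:
  fixes h :: "real \<Rightarrow> real"
  assumes h: "convex_on UNIV h" and x: "x \<in> {lo..hi}"
    and min: "\<And>z. z \<in> {lo..hi} \<Longrightarrow> h x \<le> h z"
  obtains s where "\<And>z. h x + s * (z - x) \<le> h z" "\<And>z. z \<in> {lo..hi} \<Longrightarrow> 0 \<le> s * (z - x)"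
proof (cases "\<forall>z. h x \<le> h z")
  case True
  with that[of 0] show ?thesis by simp
next
  case False
  then obtain y where y: "h y < h x" by (auto simp: not_le)
  obtain s where s: "\<And>z. h x + s * (z - x) \<le> h z" using subgradient_exists[OF h] by blast
  have sy: "s * (y - x) < 0" using s[of y] y by linarith
  have out: "y \<notin> {lo..hi}" using min y by force
  have "(z - x) * (y - x) \<le> 0" if z: "z \<in> {lo..hi}" for z
  proof (rule ccontr)
    assume pos: "\<not> ?thesis"
    \<comment> \<open>If \<open>z\<close> were on the same side of \<open>x\<close> as
      \<open>y\<close>, it would lie between them at ratio \<open>r\<close>, and convexity would
      give \<open>h z < h x\<close>.\<close>
    define r where "r = (z - x) / (y - x)"
    have yx: "y \<noteq> x" using y by auto
    have "0 < r" using pos by (auto simp: r_def zero_less_divide_iff zero_less_mult_iff not_le)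
    moreover have "r \<le> 1"
      using pos yx out x z by (auto simp: r_def divide_le_eq_1 zero_less_mult_iff not_le)
    moreover have "z = (1 - r) * x + r * y"
    proof -
      have "r * (y - x) = z - x" using yx by (simp add: r_def)
      then show ?thesis by (simp add: algebra_simps)
    qed
    ultimately have "h z \<le> (1 - r) * h x + r * h y" "r * h y < r * h x"
      using convex_onD[OF h, of r x y] y by auto
    then show False using min[OF z] by (simp add: algebra_simps)
  qed
  then have "0 \<le> s * (z - x)" if "z \<in> {lo..hi}" for z
    using sy that by (force simp: mult_less_0_iff mult_le_0_iff zero_le_mult_iff)
  with s that show ?thesis by blast
qed

text \<open>\<open>x\<close> minimises \<open>f0 + f2 - \<nu> x\<close> over the interval, with the subgradient \<open>s\<close> of \<open>f2\<close> recorded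
  separately because it determines the equilibrium value of \<open>\<eta>\<close>, namely \<open>- s / \<kappa>\<close>.\<close>

definition bus_optimal :: "(real \<Rightarrow> real) \<Rightarrow> (real \<Rightarrow> real) \<Rightarrow> real \<Rightarrow> real \<Rightarrow> real \<Rightarrow> real \<Rightarrow> real \<Rightarrow> bool" where
  "bus_optimal f0 f2 lo hi \<nu> x s \<longleftrightarrow> x \<in> {lo..hi} \<and> (\<forall>z. f2 x + s * (z - x) \<le> f2 z)
     \<and> (\<forall>z\<in>{lo..hi}. 0 \<le> (deriv f0 x + s - \<nu>) * (z - x))"

text \<open>A minimiser exists by compactness. Its variational inequality replaces \<open>f0\<close>
  by a linear term of slope \<open>c\<close>; the remaining problem is convex, and subtracting
  \<open>c\<close> from its subgradient gives one of \<open>f2\<close>.\<close>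

lemma bus_optimal_exists:
  fixes f0 f2 :: "real \<Rightarrow> real"
  assumes f0: "\<And>x. f0 differentiable (at x)" and f2: "convex_on UNIV f2" and ne: "lo \<le> hi"
  obtains x s where "bus_optimal f0 f2 lo hi \<nu> x s"
proof -
  have d0: "(f0 has_real_derivative deriv f0 x) (at x)" for x
    using f0 by (simp add: DERIV_deriv_iff_real_differentiable)
  have "continuous_on {lo..hi} (\<lambda>x. f2 x + (f0 x - \<nu> * x))"
    by (intro continuous_intros continuous_on_subset[OF convex_on_continuous[OF open_UNIV f2]]
        DERIV_continuous_on[OF DERIV_subset[OF d0]]) auto
  then obtain x where x: "x \<in> {lo..hi}"
    and min: "\<And>z. z \<in> {lo..hi} \<Longrightarrow> f2 x + (f0 x - \<nu> * x) \<le> f2 z + (f0 z - \<nu> * z)"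
    using continuous_attains_inf[of "{lo..hi}" "\<lambda>x. f2 x + (f0 x - \<nu> * x)"] ne
    by (auto simp: Ball_def)
  define c where "c = deriv f0 x - \<nu>"
  have "((\<lambda>x. f0 x - \<nu> * x) has_real_derivative c) (at x)"
    unfolding c_def by (auto intro!: derivative_eq_intros d0)
  note var_ineq = minimizer_variational_ineq[OF convex_on_subset[OF f2 subset_UNIV] this x min]
  have lin_min: "f2 x + c * x \<le> f2 z + c * z" if "z \<in> {lo..hi}" for z
    using var_ineq[of z] that by (simp add: algebra_simps)
  have lin_convex: "convex_on UNIV (\<lambda>z. f2 z + c * z)"
    by (intro convex_on_add f2 convex_on_realI[where f' = "\<lambda>_. c"]) (auto intro!: derivative_eq_intros)
  have "\<exists>s. (\<forall>z. f2 x + c * x + s * (z - x) \<le> f2 z + c * z) \<and> (\<forall>z\<in>{lo..hi}. 0 \<le> s * (z - x))"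
    by (rule constrained_min_subgradient[OF lin_convex x lin_min]) blast+
  then obtain s where "\<And>z. f2 x + c * x + s * (z - x) \<le> f2 z + c * z"
    "\<And>z. z \<in> {lo..hi} \<Longrightarrow> 0 \<le> s * (z - x)" by blast
  then have "bus_optimal f0 f2 lo hi \<nu> x (s - c)"
    using x by (auto simp: bus_optimal_def c_def algebra_simps)
  then show ?thesis using that by blast
qed

text \<open>Each optimality condition is tested at the other point; in the sum \<open>f2\<close> and
  its subgradients cancel. Monotone and Lipschitz dependence of the optimum on the multiplier
  follows.\<close>

lemma bus_optimal_strongly_mono:
  assumes f0: "\<And>x. f0 differentiable (at x)" "strongly_convex \<beta> f0"
    and opt: "bus_optimal f0 f2 lo hi \<nu> x s" "bus_optimal f0 f2 lo hi \<nu>' x' s'"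
  shows "\<beta> * (x - x')\<^sup>2 \<le> (\<nu> - \<nu>') * (x - x')"
proof -
  have "\<beta> * (x - x')\<^sup>2 \<le> (deriv f0 x - deriv f0 x') * (x - x')"
    by (rule strongly_convex_deriv_strongly_mono[OF f0(2) f0(1) f0(1)])
  moreover have "0 \<le> (deriv f0 x + s - \<nu>) * (x' - x)" "0 \<le> (deriv f0 x' + s' - \<nu>') * (x - x')"
    "f2 x + s * (x' - x) \<le> f2 x'" "f2 x' + s' * (x - x') \<le> f2 x"
    using opt by (auto simp: bus_optimal_def)
  ultimately show ?thesis by (simp add: algebra_simps)
qed

lemma economic_dispatch_exists:
  fixes f0 f2 :: "'n::finite \<Rightarrow> real \<Rightarrow> real"
  assumes f0: "\<And>i x. f0 i differentiable (at x)" "\<And>i. strongly_convex \<beta> (f0 i)" "0 < \<beta>"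
    and f2: "\<And>i. convex_on UNIV (f2 i)" and ne: "\<And>i. lo i \<le> hi i"
    and S: "(\<Sum>i\<in>UNIV. lo i) \<le> S" "S \<le> (\<Sum>i\<in>UNIV. hi i)"
  obtains \<nu> x s where "\<And>i. bus_optimal (f0 i) (f2 i) (lo i) (hi i) \<nu> (x i) (s i)"
    "(\<Sum>i\<in>UNIV. x i) = S"
proof -
  have "\<exists>x s. bus_optimal (f0 i) (f2 i) (lo i) (hi i) \<nu> x s" for i \<nu>
    by (rule bus_optimal_exists[OF f0(1) f2 ne]) blast
  then obtain x s where opt: "\<And>i \<nu>. bus_optimal (f0 i) (f2 i) (lo i) (hi i) \<nu> (x i \<nu>) (s i \<nu>)"
    by metis
  note sm = bus_optimal_strongly_mono[OF f0(1,2)]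
  have le_if_strongly_mono: "y \<le> y'" if "\<beta> * (y - y')\<^sup>2 \<le> (\<nu> - \<nu>') * (y - y')" "\<nu> \<le> \<nu>'" "0 < \<beta>" for y y' \<nu> \<nu>'
  proof (rule ccontr)
    assume "\<not> ?thesis"
    then have "0 < \<beta> * (y - y')\<^sup>2" "(\<nu> - \<nu>') * (y - y') \<le> 0"
      using that by (auto intro!: mult_pos_pos mult_nonpos_nonneg)
    with that(1) show False by linarith
  qed
  have lip: "\<beta> * \<bar>x i \<nu> - x i \<nu>'\<bar> \<le> \<bar>\<nu> - \<nu>'\<bar>" for i \<nu> \<nu>'
  proof (cases "x i \<nu> = x i \<nu>'")
    case False
    have "\<beta> * \<bar>x i \<nu> - x i \<nu>'\<bar> * \<bar>x i \<nu> - x i \<nu>'\<bar> \<le> \<bar>\<nu> - \<nu>'\<bar> * \<bar>x i \<nu> - x i \<nu>'\<bar>"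
      using sm[OF opt[of i \<nu>] opt[of i \<nu>']] abs_ge_self[of "(\<nu> - \<nu>') * (x i \<nu> - x i \<nu>')"]
      by (simp add: power2_eq_square abs_mult mult.assoc)
    then show ?thesis using False by simp
  qed auto
  have "continuous_on UNIV (x i)" for i
  proof (rule continuous_onI)
    fix \<nu> e :: real assume "0 < e"
    have "\<bar>x i \<nu>' - x i \<nu>\<bar> \<le> e" if "\<bar>\<nu>' - \<nu>\<bar> < \<beta> * e" for \<nu>'
    proof -
      have "\<beta> * \<bar>x i \<nu>' - x i \<nu>\<bar> \<le> \<beta> * e" using lip[of i \<nu>' \<nu>] that by linarith
      then show ?thesis using f0(3) by simp
    qed
    then show "\<exists>d>0. \<forall>\<nu>'\<in>UNIV. dist \<nu>' \<nu> < d \<longrightarrow> dist (x i \<nu>') (x i \<nu>) \<le> e"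
      using \<open>0 < e\<close> f0(3) by (intro exI[of _ "\<beta> * e"]) (auto simp: dist_real_def)
  qed
  then have cont: "continuous_on A (\<lambda>\<nu>. \<Sum>i\<in>UNIV. x i \<nu>)" for A
    by (intro continuous_on_sum) (auto intro: continuous_on_subset)
  have "\<exists>r. \<forall>z. f2 i x + r * (z - x) \<le> f2 i z" for i x
    by (rule subgradient_exists[OF f2]) blast
  then obtain r where r: "\<And>i x z. f2 i x + r i x * (z - x) \<le> f2 i z" by metis
  text \<open>For a multiplier beyond the slope of the cost at an endpoint, that endpoint is optimal.\<close>
  define m where "m i = deriv (f0 i) (lo i) + r i (lo i)" for i
  define M where "M i = deriv (f0 i) (hi i) + r i (hi i)" for i
  \<comment> \<open>Including 0 in both sets gives \<open>a \<le> 0 \<le> b\<close>, so the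
    intermediate value theorem has an interval to work on.\<close>
  define a where "a = Min (insert 0 (range m))"
  define b where "b = Max (insert 0 (range M))"
  have lo: "x i \<nu> \<le> lo i" if "\<nu> \<le> m i" for i \<nu>
  proof -
    have "bus_optimal (f0 i) (f2 i) (lo i) (hi i) (m i) (lo i) (r i (lo i))"
      using r ne by (auto simp: bus_optimal_def m_def)
    from sm[OF opt[of i \<nu>] this] that f0(3) show ?thesis by (rule le_if_strongly_mono)
  qed
  have hi: "hi i \<le> x i \<nu>" if "M i \<le> \<nu>" for i \<nu>
  proof -
    have "bus_optimal (f0 i) (f2 i) (lo i) (hi i) (M i) (hi i) (r i (hi i))"
      using r ne by (auto simp: bus_optimal_def M_def)
    from sm[OF this opt[of i \<nu>]] that f0(3) show ?thesis by (rule le_if_strongly_mono)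
  qed
  have "(\<Sum>i\<in>UNIV. x i a) \<le> (\<Sum>i\<in>UNIV. lo i)"
    by (intro sum_mono lo) (simp add: a_def Min_le del: Min_insert)
  moreover have "(\<Sum>i\<in>UNIV. hi i) \<le> (\<Sum>i\<in>UNIV. x i b)"
    by (intro sum_mono hi) (simp add: b_def Max_ge del: Max_insert)
  moreover have "a \<le> b"
    by (rule order_trans[of _ 0]) (auto simp: a_def b_def)
  ultimately have "\<exists>\<nu>\<ge>a. \<nu> \<le> b \<and> (\<Sum>i\<in>UNIV. x i \<nu>) = S"
    using S cont by (intro IVT') (auto intro: order_trans)
  then obtain \<nu> where "(\<Sum>i\<in>UNIV. x i \<nu>) = S" by blast
  with opt show ?thesis by (rule that)
qed

section \<open>Network flows\<close>

definition outflow :: "('n::finite \<times> 'n) set \<Rightarrow> ('n \<times> 'n \<Rightarrow> real) \<Rightarrow> 'n \<Rightarrow> real" where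
  "outflow E P i = (\<Sum>j\<in>{j. (i, j) \<in> E}. P (i, j)) - (\<Sum>k\<in>{k. (k, i) \<in> E}. P (k, i))"

text \<open>Factored as incidence matrix times weighted edge differences, so that symmetry and the
  energy form both come from \<open>outflow_adjoint\<close>.\<close>

definition laplacian :: "('n::finite \<times> 'n) set \<Rightarrow> ('n \<times> 'n \<Rightarrow> real) \<Rightarrow> ('n \<Rightarrow> real) \<Rightarrow> 'n \<Rightarrow> real" where
  "laplacian E B w = outflow E (\<lambda>e. B e * (w (fst e) - w (snd e)))"

text \<open>Summation by parts: an edge counts positively at its tail and negatively at its head,
  and each double sum over buses is a sum over edges.\<close>

lemma outflow_adjoint:
  fixes E :: "('n::finite \<times> 'n) set"
  shows "(\<Sum>i\<in>UNIV. a i * outflow E P i) = (\<Sum>e\<in>E. P e * (a (fst e) - a (snd e)))"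
proof -
  have out: "(\<Sum>i\<in>UNIV. \<Sum>j\<in>{j. (i, j) \<in> E}. a i * P (i, j)) = (\<Sum>e\<in>E. P e * a (fst e))"
    by (subst sum.Sigma) (auto intro!: sum.cong simp: split_def mult.commute)
  have "(\<Sum>i\<in>UNIV. \<Sum>k\<in>{k. (k, i) \<in> E}. a i * P (k, i)) = (\<Sum>e\<in>E. P e * a (snd e))"
    by (subst sum.Sigma, simp, simp, rule sum.reindex_bij_witness[where i = prod.swap and j = prod.swap])
      (auto simp: mult.commute)
  with out show ?thesis
    by (simp add: outflow_def right_diff_distrib sum_distrib_left sum_subtractf)
qed

lemma outflow_diff: "outflow E (\<lambda>e. P e - Q e) i = outflow E P i - outflow E Q i"
  by (simp add: outflow_def sum_subtractf)

lemma laplacian_adjoint: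
  "(\<Sum>i\<in>UNIV. a i * laplacian E B w i)
     = (\<Sum>e\<in>E. B e * (w (fst e) - w (snd e)) * (a (fst e) - a (snd e)))"
  by (simp add: laplacian_def outflow_adjoint)

lemma laplacian_self_adjoint:
  "(\<Sum>i\<in>UNIV. a i * laplacian E B w i) = (\<Sum>i\<in>UNIV. w i * laplacian E B a i)"
  by (simp add: laplacian_adjoint mult_ac)

lemma laplacian_add: "laplacian E B (\<lambda>k. v k + w k) i = laplacian E B v i + laplacian E B w i"
  by (simp add: laplacian_def outflow_def algebra_simps sum.distrib sum_subtractf)

lemma laplacian_diff: "laplacian E B (\<lambda>k. v k - w k) i = laplacian E B v i - laplacian E B w i"
  by (simp add: laplacian_def outflow_def algebra_simps sum.distrib sum_subtractf)

lemma laplacian_scale: "laplacian E B (\<lambda>k. c * w k) i = c * laplacian E B w i"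
  by (simp add: laplacian_def outflow_def algebra_simps sum.distrib sum_subtractf sum_distrib_left)

lemma sum_laplacian [simp]: "(\<Sum>i\<in>UNIV. laplacian E B w i) = 0"
  using laplacian_adjoint[of "\<lambda>_. 1" E B w] by simp

lemma u1_conv_outflow: "u1 E Pin D d \<omega> P i = Pin i - d i - D i * \<omega> i - outflow E P i"
  by (simp add: u1_def outflow_def)

lemma u2_conv_laplacian: "u2 E B Pin d \<theta> i = Pin i - d i - laplacian E B \<theta> i"
  by (simp add: u2_def laplacian_def outflow_def)

lemma connected_edgewise_const:
  assumes "graph_connected E" and eq: "\<And>e. e \<in> E \<Longrightarrow> w (fst e) = w (snd e)"
  shows "w i = w j"
proof -
  have "(i, j) \<in> (E \<union> E\<inverse>)\<^sup>*" using assms(1) by (simp add: graph_connected_def)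
  then show ?thesis
    by (induction rule: rtrancl_induct) (use eq in fastforce)+
qed

text \<open>The part \<open>z\<close> of \<open>b\<close> orthogonal to the range has zero energy,
  hence is constant across edges and, by connectivity, everywhere; \<open>b\<close> and the range
  sum to zero, so the constant is 0.\<close>

lemma laplacian_surj_on_zero_sum:
  fixes E :: "('n::finite \<times> 'n) set"
  assumes conn: "graph_connected E" and B: "\<And>e. e \<in> E \<Longrightarrow> B e > 0"
    and b: "(\<Sum>i\<in>UNIV. b i) = 0"
  obtains \<theta> where "\<And>i. laplacian E B \<theta> i = b i"
proof -
  let ?L = "\<lambda>x::real^'n. \<chi> i. laplacian E B (\<lambda>k. x $ k) i"
  have "linear ?L"
    by (rule linearI) (simp_all add: vec_eq_iff laplacian_add laplacian_scale)
  then have "span (range ?L) = range ?L"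
    by (simp add: linear_subspace_image span_eq_iff)
  then obtain y z where y: "y \<in> range ?L" and z: "\<And>w. w \<in> range ?L \<Longrightarrow> orthogonal z w"
    and yz: "(\<chi> i. b i) = y + z"
    using orthogonal_subspace_decomp_exists[of "range ?L" "\<chi> i. b i"] by metis
  obtain x where x: "y = ?L x" using y by auto
  have "z \<bullet> ?L z = 0" using z[of "?L z"] by (simp add: orthogonal_def)
  then have "(\<Sum>e\<in>E. B e * (z $ fst e - z $ snd e)\<^sup>2) = 0"
    using laplacian_adjoint[of "\<lambda>k. z $ k" E B "\<lambda>k. z $ k"]
    by (simp add: inner_vec_def power2_eq_square mult.assoc)
  then have "\<forall>e\<in>E. B e * (z $ fst e - z $ snd e)\<^sup>2 = 0"
    using B by (subst (asm) sum_nonneg_eq_0_iff) (auto intro!: mult_nonneg_nonneg intro: less_imp_le)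
  then have "z $ fst e = z $ snd e" if "e \<in> E" for e
    using B[OF that] that by auto
  then have const: "z $ i = z $ j" for i j
    by (rule connected_edgewise_const[OF conn, of "\<lambda>k. z $ k"])
  have bz: "b i = laplacian E B (\<lambda>k. x $ k) i + z $ i" for i
    using yz by (simp add: x vec_eq_iff)
  have "(\<Sum>i\<in>UNIV. z $ i) = 0" using b by (simp add: bz sum.distrib)
  moreover have "(\<Sum>i\<in>UNIV. z $ i) = (\<Sum>i\<in>(UNIV::'n set). z $ j)" for j
    by (intro sum.cong refl const)
  ultimately have "z $ i = 0" for i by simp
  then show ?thesis using bz that[of "\<lambda>k. x $ k"] by simp
qed

section \<open>Dissipation\<close>

lemma Liminf_sqrt_times_dissipation_finite:
  fixes V V' S :: "real \<Rightarrow> real"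
  assumes V: "\<And>t. 0 < t \<Longrightarrow> (V has_real_derivative V' t) (at t)" "\<And>t. 0 < t \<Longrightarrow> 0 \<le> V t"
    and diss: "\<And>t. 0 < t \<Longrightarrow> V' t \<le> - c * (S t)\<^sup>2" and c: "0 < c"
  shows "Liminf at_top (\<lambda>t. ereal (sqrt t * S t)) < \<infinity>"
proof (rule ccontr)
  assume "\<not> ?thesis"
  \<comment> \<open>The negated goal makes the Liminf infinite, so it exceeds any threshold; 1 is a
    convenient one.\<close>
  then have "ereal 1 < Liminf at_top (\<lambda>t. ereal (sqrt t * S t))" by simp
  from less_LiminfD[OF this] obtain T0 where T0: "\<And>t. T0 \<le> t \<Longrightarrow> 1 < sqrt t * S t"
    by (auto simp: eventually_at_top_linorder)
  define T where "T = max T0 1"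
  have T: "0 < T" "T0 \<le> T" by (auto simp: T_def)
  text \<open>\<open>V + c ln t\<close> is nonincreasing beyond \<open>T\<close>, so \<open>V\<close> would become negative.\<close>
  have decr: "V' t + c / t \<le> 0" if "T \<le> t" for t
  proof -
    have t: "0 < t" "1 < sqrt t * S t" using T that T0 by auto
    then have "1 \<le> (sqrt t * S t)\<^sup>2" by (simp add: one_le_power)
    then have "1 / t \<le> (S t)\<^sup>2" using t by (simp add: power_mult_distrib field_simps)
    then have "c / t \<le> c * (S t)\<^sup>2" using c mult_left_mono[of "1 / t" "(S t)\<^sup>2" c] by simp
    then show ?thesis using diss[of t] t by simp
  qed
  \<comment> \<open>Chosen so that \<open>c * ln t\<close> exceeds \<open>c * ln T\<close> by
    \<open>V T + 1\<close>, which forces \<open>V t \<le> - 1\<close>.\<close>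
  define t where "t = T * exp ((V T + 1) / c)"
  have "T \<le> t" using T c V(2)[of T] by (simp add: t_def)
  then have "V t + c * ln t \<le> V T + c * ln T"
    by (rule DERIV_nonpos_imp_nonincreasing)
      (use T in \<open>auto intro!: derivative_eq_intros V(1) exI conjI decr\<close>)
  moreover have "ln t = ln T + (V T + 1) / c" using T by (simp add: t_def ln_mult)
  ultimately have "V t + c * ((V T + 1) / c) \<le> V T" by (simp add: distrib_left)
  then have "V t < 0" using c by simp
  then show False using V(2)[of t] T \<open>T \<le> t\<close> by linarith
qed

text \<open>\<open>\<delta>\<close> stands for the increase of \<open>f2\<close> from
  \<open>ds\<close> to \<open>d + \<eta>'\<close>. Adding the \<open>proj\<close> and
  \<open>prox\<close> inequalities cancels \<open>\<delta>\<close>, \<open>\<nu>\<close> and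
  \<open>\<kappa> * (\<eta> - \<eta>s) * (d - ds)\<close>; completing the square in
  \<open>d - ds\<close> then fixes the factor of \<open>\<eta>'\<^sup>2\<close>.\<close>

lemma primal_dissipation:
  fixes \<kappa> \<beta> d d' \<eta> \<eta>' ds \<eta>s g gs a b \<nu> :: real
  assumes "1 < \<beta>"
    and proj: "((d - g + \<kappa> * \<eta> + a + (b + \<nu>)) - (d + d')) * (ds - (d + d')) \<le> 0"
      "0 \<le> (gs - \<kappa> * \<eta>s - \<nu>) * ((d + d') - ds)"
    and prox: "((d - \<kappa> * \<eta>) - (d + \<eta>')) * (ds - (d + \<eta>')) \<le> - \<delta>"
      "- (\<kappa> * \<eta>s) * ((d + \<eta>') - ds) \<le> \<delta>"
    and mono: "\<beta> * (d - ds)\<^sup>2 \<le> (g - gs) * (d - ds)"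
  shows "(d - ds) * d' + \<kappa> * (\<eta> - \<eta>s) * \<eta>' - \<kappa> * (\<eta>' * (d - ds) + (\<eta> - \<eta>s) * d') + (g - gs) * d'
    \<le> (a + b) * (d - ds + d') - d'\<^sup>2 - (1 - ((1 + \<kappa>) / 2)\<^sup>2) * \<eta>'\<^sup>2"
proof -
  have "1 * (d - ds)\<^sup>2 \<le> \<beta> * (d - ds)\<^sup>2"
    using \<open>1 < \<beta>\<close> by (intro mult_right_mono) auto
  moreover have "0 \<le> ((d - ds) + (1 + \<kappa>) / 2 * \<eta>')\<^sup>2" by simp
  ultimately show ?thesis
    using proj prox mono by (simp add: power2_eq_square field_simps)
qed

text \<open>\<open>y\<close> stands for the outflow of \<open>P'\<close>. Since
  \<open>u = 2 * l'\<close>, damping contributes \<open>- D * (l + 2 * l') * (l + l')\<close>; the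
  weight 3 in the Lyapunov function is what cancels its mixed term, leaving nonpositive
  squares.\<close>

lemma frequency_dissipation:
  fixes D l l' d ds d' u a y :: real
  assumes "0 < D" "l' = u / 2" "a = l + u"
  shows "l * l' + a * (l' - d' - D * l' - y) + 3 * D * l * l' + a * (- u - (d - ds) - D * l)
    + a * (d - ds + d') \<le> - 2 * l'\<^sup>2 - a * y"
proof -
  have "0 \<le> D * l\<^sup>2" "0 \<le> D * u\<^sup>2" using assms(1) by simp_all
  then show ?thesis unfolding assms(2,3) by (simp add: power2_eq_square field_simps)
qed

text \<open>The same computation without damping, hence an equality; \<open>y\<close> stands for the
  Laplacian of \<open>\<theta>'\<close>.\<close>

lemma multiplier_dissipation:
  fixes m m' d ds d' u b y :: real
  assumes "m' = u / 2" "b = m + u"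
  shows "m * m' + b * (m' - d' - y) + b * (- u - (d - ds)) + b * (d - ds + d')
    = - 2 * m'\<^sup>2 - b * y"
  unfolding assms by (simp add: power2_eq_square field_simps)

lemma primal_lyapunov_nonneg:
  fixes \<kappa> x y :: real
  assumes "0 < \<kappa>" "\<kappa> < 1"
  shows "0 \<le> x\<^sup>2 / 2 + \<kappa> / 2 * y\<^sup>2 - \<kappa> * (y * x)"
proof -
  have "0 \<le> \<kappa> / 2 * (y - x)\<^sup>2 + (1 - \<kappa>) / 2 * x\<^sup>2" using assms by simp
  then show ?thesis by (simp add: power2_eq_square field_simps)
qed

lemma vnorm_power2: "(vnorm I x)\<^sup>2 = (\<Sum>i\<in>I. (x i)\<^sup>2)"
  by (simp add: vnorm_def sum_nonneg)

lemma sum6_power2_le: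
  fixes a b c d e f :: real
  shows "(a + b + c + d + e + f)\<^sup>2 \<le> 6 * (a\<^sup>2 + b\<^sup>2 + c\<^sup>2 + d\<^sup>2 + e\<^sup>2 + f\<^sup>2)"
proof -
  have "0 \<le> (a-b)\<^sup>2 + (a-c)\<^sup>2 + (a-d)\<^sup>2 + (a-e)\<^sup>2 + (a-f)\<^sup>2 + (b-c)\<^sup>2 + (b-d)\<^sup>2 + (b-e)\<^sup>2 + (b-f)\<^sup>2
      + (c-d)\<^sup>2 + (c-e)\<^sup>2 + (c-f)\<^sup>2 + (d-e)\<^sup>2 + (d-f)\<^sup>2 + (e-f)\<^sup>2" by simp
  then show ?thesis by (simp add: power2_eq_square algebra_simps)
qed

theorem theorem3:
  fixes E :: "('n::finite \<times> 'n) set"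
    and B :: "'n \<times> 'n \<Rightarrow> real"
    and D Pin dlo dhi :: "'n \<Rightarrow> real"
    and Plo Phi :: "'n \<times> 'n \<Rightarrow> real"
    and f0 f2 :: "'n \<Rightarrow> real \<Rightarrow> real"
    and \<beta> \<kappa> :: real
    and \<eta> d \<theta> lam mu \<omega> :: "real \<Rightarrow> 'n \<Rightarrow> real"
    and P :: "real \<Rightarrow> 'n \<times> 'n \<Rightarrow> real"
    and \<eta>' d' \<theta>' lam' mu' \<omega>' :: "real \<Rightarrow> 'n \<Rightarrow> real"
    and P' :: "real \<Rightarrow> 'n \<times> 'n \<Rightarrow> real"
  assumes conn: "graph_connected E"
    and B_pos: "\<And>e. e \<in> E \<Longrightarrow> B e > 0"
    and D_pos: "\<And>i. D i > 0"
    and f0_diff: "\<And>i x. f0 i differentiable (at x)"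
    and f2_convex: "\<And>i. convex_on UNIV (f2 i)"
    and f2_lsc: "\<And>i. lsc (f2 i)"
    and ass1: "\<beta> > 1" "\<And>i. strongly_convex \<beta> (f0 i)"
    and Plim: "\<And>e. e \<in> E \<Longrightarrow> Plo e \<le> Phi e"
    and slater: "\<exists>dt::real^'n. \<exists>tht::'n \<Rightarrow> real.
        dt \<in> rel_interior {x. \<forall>i. dlo i \<le> x $ i \<and> x $ i \<le> dhi i}
        \<and> (\<forall>i. u2 E B Pin (\<lambda>k. dt $ k) tht i = 0)
        \<and> (\<forall>e\<in>E. Plo e < B e * (tht (fst e) - tht (snd e))
                  \<and> B e * (tht (fst e) - tht (snd e)) < Phi e)"
    and kappa: "0 < \<kappa>" "\<kappa> < 1"
    and deriv_\<eta>: "\<And>t i. t \<ge> 0 \<Longrightarrow> ((\<lambda>s. \<eta> s i) has_real_derivative \<eta>' t i) (at t within {0..})"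
    and deriv_d: "\<And>t i. t \<ge> 0 \<Longrightarrow> ((\<lambda>s. d s i) has_real_derivative d' t i) (at t within {0..})"
    and deriv_\<theta>: "\<And>t i. t \<ge> 0 \<Longrightarrow> ((\<lambda>s. \<theta> s i) has_real_derivative \<theta>' t i) (at t within {0..})"
    and deriv_P: "\<And>t e. t \<ge> 0 \<Longrightarrow> e \<in> E \<Longrightarrow> ((\<lambda>s. P s e) has_real_derivative P' t e) (at t within {0..})"
    and deriv_lam: "\<And>t i. t \<ge> 0 \<Longrightarrow> ((\<lambda>s. lam s i) has_real_derivative lam' t i) (at t within {0..})"
    and deriv_mu: "\<And>t i. t \<ge> 0 \<Longrightarrow> ((\<lambda>s. mu s i) has_real_derivative mu' t i) (at t within {0..})"
    and deriv_\<omega>: "\<And>t i. t \<ge> 0 \<Longrightarrow> ((\<lambda>s. \<omega> s i) has_real_derivative \<omega>' t i) (at t within {0..})"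
    and dyn_\<eta>: "\<And>t i. t \<ge> 0 \<Longrightarrow>
        \<eta>' t i = prox (\<lambda>x. ereal (f2 i x)) (d t i - \<kappa> * \<eta> t i) - d t i"
    and dyn_d: "\<And>t i. t \<ge> 0 \<Longrightarrow>
        d' t i = prox (ind {dlo i..dhi i})
                   (d t i - deriv (f0 i) (d t i) + \<kappa> * \<eta> t i + lam t i
                    + u1 E Pin D (d t) (\<omega> t) (P t) i + mu t i + u2 E B Pin (d t) (\<theta> t) i)
                 - d t i"
    and dyn_\<omega>: "\<And>t i. t \<ge> 0 \<Longrightarrow> \<omega> t i = lam t i"
    and dyn_\<theta>: "\<And>t i. t \<ge> 0 \<Longrightarrow>
        \<theta>' t i = (\<Sum>j\<in>{j. (i, j) \<in> E}. B (i, j) *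
                      ((mu t i + u2 E B Pin (d t) (\<theta> t) i) - (mu t j + u2 E B Pin (d t) (\<theta> t) j)))
                - (\<Sum>k\<in>{k. (k, i) \<in> E}. B (k, i) *
                      ((mu t k + u2 E B Pin (d t) (\<theta> t) k) - (mu t i + u2 E B Pin (d t) (\<theta> t) i)))"
    and dyn_P: "\<And>t i j. t \<ge> 0 \<Longrightarrow> (i, j) \<in> E \<Longrightarrow>
        P' t (i, j) = (lam t i + u1 E Pin D (d t) (\<omega> t) (P t) i)
                    - (lam t j + u1 E Pin D (d t) (\<omega> t) (P t) j)"
    and dyn_lam: "\<And>t i. t \<ge> 0 \<Longrightarrow> lam' t i = u1 E Pin D (d t) (\<omega> t) (P t) i / 2"
    and dyn_mu: "\<And>t i. t \<ge> 0 \<Longrightarrow> mu' t i = u2 E B Pin (d t) (\<theta> t) i / 2"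
  shows "Liminf at_top (\<lambda>t. ereal (sqrt t *
           (vnorm UNIV (d' t) + vnorm UNIV (\<eta>' t) + vnorm UNIV (\<theta>' t)
            + vnorm E (P' t) + vnorm UNIV (mu' t) + vnorm UNIV (\<omega>' t)))) < \<infinity>"
proof -

  \<comment> \<open>Construction of an equilibrium\<close>
  obtain dt :: "real^'n" and tht where dt: "dt \<in> rel_interior {x. \<forall>i. dlo i \<le> x $ i \<and> x $ i \<le> dhi i}"
    and tht: "\<And>i. u2 E B Pin (\<lambda>k. dt $ k) tht i = 0"
    using slater by blast
  \<comment> \<open>Feasibility of the Slater point makes every interval nonempty and, as a
    Laplacian sums to zero, puts the total injection between the total bounds.\<close>
  have box: "dlo i \<le> dt $ i" "dt $ i \<le> dhi i" for i
    using subsetD[OF rel_interior_subset dt] by auto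
  have ne: "dlo i \<le> dhi i" for i using box[of i] by linarith
  have Pin_dt: "Pin i = dt $ i + laplacian E B tht i" for i
    using tht[of i] by (simp add: u2_conv_laplacian)
  have S: "(\<Sum>i\<in>UNIV. Pin i) = (\<Sum>i\<in>UNIV. dt $ i)"
    by (simp add: Pin_dt sum.distrib)
  obtain \<nu> ds s where opt: "\<And>i. bus_optimal (f0 i) (f2 i) (dlo i) (dhi i) \<nu> (ds i) (s i)"
    and ds: "(\<Sum>i\<in>UNIV. ds i) = (\<Sum>i\<in>UNIV. Pin i)"
  proof (rule economic_dispatch_exists[of f0 \<beta> f2 dlo dhi, OF f0_diff ass1(2) _ f2_convex ne])
    show "0 < \<beta>" using ass1(1) by simp
    show "(\<Sum>i\<in>UNIV. dlo i) \<le> (\<Sum>i\<in>UNIV. Pin i)" "(\<Sum>i\<in>UNIV. Pin i) \<le> (\<Sum>i\<in>UNIV. dhi i)"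
      unfolding S by (auto intro: sum_mono box)
  qed blast
  obtain \<theta>s where \<theta>s: "\<And>i. laplacian E B \<theta>s i = Pin i - ds i"
    using laplacian_surj_on_zero_sum[of E B "\<lambda>i. Pin i - ds i"] conn B_pos ds
    by (auto simp: sum_subtractf)
  \<comment> \<open>The flow induced by the equilibrium angles balances every bus, so
    \<open>u1\<close> (at zero frequency) and \<open>u2\<close> both vanish at the
    equilibrium.\<close>
  define Ps where "Ps e = B e * (\<theta>s (fst e) - \<theta>s (snd e))" for e
  have Ps: "outflow E Ps i = Pin i - ds i" for i
    using \<theta>s[of i] by (simp add: laplacian_def Ps_def[abs_def])
  define \<eta>s where "\<eta>s i = - s i / \<kappa>" for i
  have s: "s i = - (\<kappa> * \<eta>s i)" for i using kappa by (simp add: \<eta>s_def)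

  \<comment> \<open>Shifted variables and the Lyapunov function\<close>
  define U1 where "U1 t i = Pin i - d t i - D i * lam t i - outflow E (P t) i" for t i
  define U2 where "U2 t i = Pin i - d t i - laplacian E B (\<theta> t) i" for t i
  define a where "a t i = lam t i + U1 t i" for t i
  \<comment> \<open>The shift by \<open>\<nu>\<close> makes \<open>b\<close> vanish at the
    equilibrium and leaves the differences driving \<open>\<theta>\<close> unchanged.\<close>
  define b where "b t i = (mu t i - \<nu>) + U2 t i" for t i
  have u1: "u1 E Pin D (d t) (\<omega> t) (P t) i = U1 t i" if "0 \<le> t" for t i
    using that by (simp add: u1_conv_outflow U1_def dyn_\<omega>)
  have u2: "u2 E B Pin (d t) (\<theta> t) i = U2 t i" for t i
    by (simp add: u2_conv_laplacian U2_def)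
  have at: "at t within {0..} = at t" if "0 < t" for t :: real
    using that by (intro at_within_interior) simp
  have \<omega>': "\<omega>' t i = lam' t i" if t: "0 < t" for t i
  proof -
    have "((\<lambda>s. \<omega> s i) has_real_derivative lam' t i) (at t within {0..})"
      by (rule has_field_derivative_transform_within[OF deriv_lam, of t 1]) (use t in \<open>auto simp: dyn_\<omega>\<close>)
    then show ?thesis
      using deriv_\<omega>[of t i] t at[OF t] DERIV_unique by fastforce
  qed
  have P': "P' t e = a t (fst e) - a t (snd e)" if "0 \<le> t" "e \<in> E" for t e
    using dyn_P[of t "fst e" "snd e"] that by (simp add: u1 a_def)
  have b_diff: "b t i - b t j = (mu t i + U2 t i) - (mu t j + U2 t j)" for t i j
    by (simp add: b_def)
  have \<theta>': "\<theta>' t i = laplacian E B (b t) i" if "0 \<le> t" for t i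
    using dyn_\<theta>[of t i] that by (simp add: laplacian_def outflow_def u2 b_diff)
  define v where "v t i = (d t i - ds i)\<^sup>2 / 2 + \<kappa> / 2 * (\<eta> t i - \<eta>s i)\<^sup>2
      - \<kappa> * ((\<eta> t i - \<eta>s i) * (d t i - ds i))
      + (f0 i (d t i) - f0 i (ds i) - deriv (f0 i) (ds i) * (d t i - ds i))
      + (lam t i)\<^sup>2 / 2 + (a t i)\<^sup>2 / 2 + 3 / 2 * D i * (lam t i)\<^sup>2
      + (\<theta> t i - \<theta>s i)\<^sup>2 / 2 + (mu t i - \<nu>)\<^sup>2 / 2 + (b t i)\<^sup>2 / 2" for t i
  define V where "V t = (\<Sum>i\<in>UNIV. v t i) + (\<Sum>e\<in>E. (P t e - Ps e)\<^sup>2 / 2)" for t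
  define a' where "a' t i = lam' t i - d' t i - D i * lam' t i - outflow E (P' t) i" for t i
  define b' where "b' t i = mu' t i - d' t i - laplacian E B (\<theta>' t) i" for t i
  \<comment> \<open>\<open>X\<close>, \<open>Y\<close> and \<open>Z\<close> are the derivatives of
    the terms of \<open>v\<close> in \<open>(d, \<eta>)\<close>, \<open>(lam, a)\<close> and
    \<open>(mu, b)\<close>, one for each dissipation lemma.\<close>
  define X where "X t i = (d t i - ds i) * d' t i + \<kappa> * (\<eta> t i - \<eta>s i) * \<eta>' t i
      - \<kappa> * (\<eta>' t i * (d t i - ds i) + (\<eta> t i - \<eta>s i) * d' t i)
      + (deriv (f0 i) (d t i) - deriv (f0 i) (ds i)) * d' t i" for t i
  define Y where "Y t i = lam t i * lam' t i + a t i * a' t i + 3 * D i * lam t i * lam' t i" for t i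
  define Z where "Z t i = (mu t i - \<nu>) * mu' t i + b t i * b' t i" for t i
  define V' where "V' t = (\<Sum>i\<in>UNIV. X t i + Y t i + Z t i + (\<theta> t i - \<theta>s i) * \<theta>' t i)
      + (\<Sum>e\<in>E. (P t e - Ps e) * P' t e)" for t
  define c where "c = 1 - ((1 + \<kappa>) / 2)\<^sup>2"
  have "((1 + \<kappa>) / 2)\<^sup>2 < 1" using kappa by (simp add: power_less_one_iff)
  then have c: "0 < c" "c \<le> 1" by (auto simp: c_def)

  \<comment> \<open>Nonnegativity of the Lyapunov function\<close>
  have V_nonneg: "0 \<le> V t" for t
  proof -
    have "0 \<le> f0 i (d t i) - f0 i (ds i) - deriv (f0 i) (ds i) * (d t i - ds i)" for i
    proof -
      have "0 \<le> \<beta> / 2 * (d t i - ds i)\<^sup>2" using ass1(1) by simp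
      then show ?thesis
        using strongly_convex_above_tangent[OF ass1(2)[of i] f0_diff, of "ds i" "d t i"] by linarith
    qed
    moreover have "0 \<le> 3 / 2 * D i * (lam t i)\<^sup>2" for i
      using D_pos[of i] by simp
    ultimately have "0 \<le> v t i" for i
      unfolding v_def using primal_lyapunov_nonneg[OF kappa, of "d t i - ds i" "\<eta> t i - \<eta>s i"]
      by (intro add_nonneg_nonneg) auto
    then show ?thesis unfolding V_def by (intro add_nonneg_nonneg sum_nonneg) auto
  qed

  \<comment> \<open>Derivative along the trajectory\<close>
  have V_deriv: "(V has_real_derivative V' t) (at t)" if t: "0 < t" for t
  proof -
    have t0: "0 \<le> t" using t by simp
    note D' = deriv_\<eta>[OF t0, unfolded at[OF t]] deriv_d[OF t0, unfolded at[OF t]]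
      deriv_\<theta>[OF t0, unfolded at[OF t]] deriv_P[OF t0, unfolded at[OF t]]
      deriv_lam[OF t0, unfolded at[OF t]] deriv_mu[OF t0, unfolded at[OF t]]
    have f0': "((\<lambda>s. f0 i (d s i)) has_real_derivative deriv (f0 i) (d t i) * d' t i) (at t)" for i
      by (rule DERIV_chain2[of "f0 i"])
        (use f0_diff D' in \<open>auto simp: DERIV_deriv_iff_real_differentiable\<close>)
    have outflow': "((\<lambda>s. outflow E (P s) i) has_real_derivative outflow E (P' t) i) (at t)" for i
      unfolding outflow_def by (intro DERIV_diff DERIV_sum D') auto
    have laplacian': "((\<lambda>s. laplacian E B (\<theta> s) i) has_real_derivative laplacian E B (\<theta>' t) i) (at t)" for i
      unfolding laplacian_def outflow_def by (intro DERIV_diff DERIV_sum DERIV_cmult D')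
    have a_deriv: "((\<lambda>s. a s i) has_real_derivative a' t i) (at t)" for i
      unfolding a_def U1_def a'_def by (auto intro!: derivative_eq_intros D' outflow')
    have b_deriv: "((\<lambda>s. b s i) has_real_derivative b' t i) (at t)" for i
      unfolding b_def U2_def b'_def by (auto intro!: derivative_eq_intros D' laplacian')
    have v_deriv: "((\<lambda>s. v s i) has_real_derivative
        X t i + Y t i + Z t i + (\<theta> t i - \<theta>s i) * \<theta>' t i) (at t)" for i
      unfolding v_def X_def Y_def Z_def
      by (rule derivative_eq_intros D' f0' a_deriv b_deriv refl | simp)+ (simp add: algebra_simps)
    have "((\<lambda>s. (P s e - Ps e)\<^sup>2 / 2) has_real_derivative (P t e - Ps e) * P' t e) (at t)" if "e \<in> E" for e
      using that by (auto intro!: derivative_eq_intros D')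
    then show ?thesis unfolding V_def V'_def by (intro DERIV_add DERIV_sum v_deriv) auto
  qed

  \<comment> \<open>Dissipation inequality\<close>
  define Q where "Q t = (\<Sum>i\<in>UNIV. (d' t i)\<^sup>2) + c * (\<Sum>i\<in>UNIV. (\<eta>' t i)\<^sup>2) + (\<Sum>i\<in>UNIV. (\<theta>' t i)\<^sup>2)
      + (\<Sum>e\<in>E. (P' t e)\<^sup>2) + 2 * (\<Sum>i\<in>UNIV. (mu' t i)\<^sup>2) + 2 * (\<Sum>i\<in>UNIV. (lam' t i)\<^sup>2)" for t
  have V'_le: "V' t \<le> - Q t" if t: "0 < t" for t
  proof -
    have t0: "0 \<le> t" using t by simp
    have X: "X t i \<le> (a t i + b t i) * (d t i - ds i + d' t i) - (d' t i)\<^sup>2 - c * (\<eta>' t i)\<^sup>2" for i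
    proof -
      let ?w = "d t i - deriv (f0 i) (d t i) + \<kappa> * \<eta> t i + a t i + (b t i + \<nu>)"
      have p: "prox (ind {dlo i..dhi i}) ?w = d t i + d' t i"
        using dyn_d[OF t0, of i] by (simp add: u1[OF t0] u2 a_def b_def algebra_simps)
      have q: "prox (\<lambda>x. ereal (f2 i x)) (d t i - \<kappa> * \<eta> t i) = d t i + \<eta>' t i"
        using dyn_\<eta>[OF t0, of i] by simp
      have o: "ds i \<in> {dlo i..dhi i}" "\<And>z. f2 i (ds i) - \<kappa> * \<eta>s i * (z - ds i) \<le> f2 i z"
        "\<And>z. z \<in> {dlo i..dhi i} \<Longrightarrow> 0 \<le> (deriv (f0 i) (ds i) - \<kappa> * \<eta>s i - \<nu>) * (z - ds i)"
        using opt[of i] by (auto simp: bus_optimal_def s)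
      show ?thesis unfolding X_def c_def
      proof (rule primal_dissipation[OF ass1(1)])
        show "(?w - (d t i + d' t i)) * (ds i - (d t i + d' t i)) \<le> 0"
          using prox_ind_variational_ineq(2)[OF ne o(1), of ?w] by (simp only: p)
        show "0 \<le> (deriv (f0 i) (ds i) - \<kappa> * \<eta>s i - \<nu>) * (d t i + d' t i - ds i)"
          using o(3) prox_ind_variational_ineq(1)[OF ne, of i ?w] by (simp only: p)
        show "(d t i - \<kappa> * \<eta> t i - (d t i + \<eta>' t i)) * (ds i - (d t i + \<eta>' t i))
            \<le> - (f2 i (d t i + \<eta>' t i) - f2 i (ds i))"
          using prox_real_variational_ineq[OF f2_convex[of i], of "d t i - \<kappa> * \<eta> t i" "ds i"]
          unfolding q by simp
        show "- (\<kappa> * \<eta>s i) * (d t i + \<eta>' t i - ds i) \<le> f2 i (d t i + \<eta>' t i) - f2 i (ds i)"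
          using o(2)[of "d t i + \<eta>' t i"] by simp
        show "\<beta> * (d t i - ds i)\<^sup>2
            \<le> (deriv (f0 i) (d t i) - deriv (f0 i) (ds i)) * (d t i - ds i)"
          by (rule strongly_convex_deriv_strongly_mono[OF ass1(2) f0_diff f0_diff])
      qed
    qed
    \<comment> \<open>The first added term is the edge part of \<open>V'\<close> moved to the buses;
      the second is the coupling left over in the bound on \<open>X\<close>. \<open>Z\<close> treats
      the angles likewise.\<close>
    have Y: "Y t i + a t i * (- U1 t i - (d t i - ds i) - D i * lam t i) + a t i * (d t i - ds i + d' t i)
        \<le> - 2 * (lam' t i)\<^sup>2 - a t i * outflow E (P' t) i" for i
      unfolding Y_def a'_def
      by (rule frequency_dissipation[OF D_pos]) (simp_all add: dyn_lam[OF t0] u1[OF t0] a_def)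
    have Z: "Z t i + b t i * (- U2 t i - (d t i - ds i)) + b t i * (d t i - ds i + d' t i)
        = - 2 * (mu' t i)\<^sup>2 - b t i * laplacian E B (\<theta>' t) i" for i
      unfolding Z_def b'_def
      by (rule multiplier_dissipation) (simp_all add: dyn_mu[OF t0] u2 b_def)
    \<comment> \<open>\<open>P'\<close> is the edge difference of \<open>a\<close>, so adjointness
      moves the sum to the buses, where the balance of \<open>Ps\<close> turns the outflow deviation
      into \<open>U1\<close>, \<open>d\<close> and \<open>lam\<close>.\<close>
    have edges: "(\<Sum>e\<in>E. (P t e - Ps e) * P' t e)
        = (\<Sum>i\<in>UNIV. a t i * (- U1 t i - (d t i - ds i) - D i * lam t i))"
    proof -
      have "(\<Sum>e\<in>E. (P t e - Ps e) * P' t e) = (\<Sum>i\<in>UNIV. a t i * outflow E (\<lambda>e. P t e - Ps e) i)"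
        unfolding outflow_adjoint by (intro sum.cong) (simp_all add: P'[OF t0])
      also have "\<dots> = (\<Sum>i\<in>UNIV. a t i * (- U1 t i - (d t i - ds i) - D i * lam t i))"
        by (intro sum.cong) (simp_all add: outflow_diff Ps U1_def)
      finally show ?thesis .
    qed
    \<comment> \<open>A second use of adjointness: the leftover from differentiating
      \<open>a\<close> is exactly the squared speed of \<open>P\<close>; \<open>angles'\<close> does
      the same for \<open>b\<close> and \<open>\<theta>\<close>.\<close>
    have edges': "(\<Sum>i\<in>UNIV. a t i * outflow E (P' t) i) = (\<Sum>e\<in>E. (P' t e)\<^sup>2)"
      unfolding outflow_adjoint by (intro sum.cong) (simp_all add: P'[OF t0] power2_eq_square)
    have angles: "(\<Sum>i\<in>UNIV. (\<theta> t i - \<theta>s i) * \<theta>' t i) = (\<Sum>i\<in>UNIV. b t i * (- U2 t i - (d t i - ds i)))"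
    proof -
      have "(\<Sum>i\<in>UNIV. (\<theta> t i - \<theta>s i) * \<theta>' t i)
          = (\<Sum>i\<in>UNIV. b t i * laplacian E B (\<lambda>k. \<theta> t k - \<theta>s k) i)"
        by (simp add: \<theta>'[OF t0] laplacian_self_adjoint[of "\<lambda>k. \<theta> t k - \<theta>s k"])
      also have "\<dots> = (\<Sum>i\<in>UNIV. b t i * (- U2 t i - (d t i - ds i)))"
        by (intro sum.cong) (simp_all add: laplacian_diff \<theta>s U2_def)
      finally show ?thesis .
    qed
    have angles': "(\<Sum>i\<in>UNIV. b t i * laplacian E B (\<theta>' t) i) = (\<Sum>i\<in>UNIV. (\<theta>' t i)\<^sup>2)"
      by (subst laplacian_self_adjoint) (simp add: \<theta>'[OF t0] power2_eq_square)
    have "V' t = (\<Sum>i\<in>UNIV. X t i + Y t i + Z t i + b t i * (- U2 t i - (d t i - ds i))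
        + a t i * (- U1 t i - (d t i - ds i) - D i * lam t i))"
      unfolding V'_def edges by (simp only: sum.distrib angles)
    also have "\<dots> \<le> (\<Sum>i\<in>UNIV. - (d' t i)\<^sup>2 - c * (\<eta>' t i)\<^sup>2 - 2 * (lam' t i)\<^sup>2 - 2 * (mu' t i)\<^sup>2
        - a t i * outflow E (P' t) i - b t i * laplacian E B (\<theta>' t) i)"
    proof (rule sum_mono)
      fix i
      show "X t i + Y t i + Z t i + b t i * (- U2 t i - (d t i - ds i))
          + a t i * (- U1 t i - (d t i - ds i) - D i * lam t i)
        \<le> - (d' t i)\<^sup>2 - c * (\<eta>' t i)\<^sup>2 - 2 * (lam' t i)\<^sup>2 - 2 * (mu' t i)\<^sup>2
          - a t i * outflow E (P' t) i - b t i * laplacian E B (\<theta>' t) i"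
        using X[of i] Y[of i] Z[of i] distrib_right[of "a t i" "b t i" "d t i - ds i + d' t i"]
        by linarith
    qed
    also have "\<dots> = - Q t"
      by (simp add: Q_def sum_subtractf sum_negf sum_distrib_left edges' angles')
    finally show ?thesis .
  qed

  \<comment> \<open>From dissipation to the decay rate\<close>
  define N where "N t = vnorm UNIV (d' t) + vnorm UNIV (\<eta>' t) + vnorm UNIV (\<theta>' t)
      + vnorm E (P' t) + vnorm UNIV (mu' t) + vnorm UNIV (\<omega>' t)" for t
  \<comment> \<open>The 6 comes from Cauchy-Schwarz over six norms; as \<open>c \<le> 1\<close>,
    every weight in \<open>Q\<close> is at least \<open>c\<close>.\<close>
  have diss: "V' t \<le> - (c / 6) * (N t)\<^sup>2" if t: "0 < t" for t
  proof -
    have "\<omega>' t = lam' t" using \<omega>'[OF t] by auto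
    then have N6: "(N t)\<^sup>2 \<le> 6 * ((\<Sum>i\<in>UNIV. (d' t i)\<^sup>2) + (\<Sum>i\<in>UNIV. (\<eta>' t i)\<^sup>2) + (\<Sum>i\<in>UNIV. (\<theta>' t i)\<^sup>2)
      + (\<Sum>e\<in>E. (P' t e)\<^sup>2) + (\<Sum>i\<in>UNIV. (mu' t i)\<^sup>2) + (\<Sum>i\<in>UNIV. (lam' t i)\<^sup>2))"
      unfolding N_def vnorm_power2[symmetric] by (simp only: sum6_power2_le)
    have le: "c * r \<le> r" "c * r \<le> 2 * r" if "0 \<le> r" for r
      using that c mult_right_mono[of c 1 r] by auto
    have "c / 6 * (N t)\<^sup>2 \<le> c * ((\<Sum>i\<in>UNIV. (d' t i)\<^sup>2) + (\<Sum>i\<in>UNIV. (\<eta>' t i)\<^sup>2) + (\<Sum>i\<in>UNIV. (\<theta>' t i)\<^sup>2)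
      + (\<Sum>e\<in>E. (P' t e)\<^sup>2) + (\<Sum>i\<in>UNIV. (mu' t i)\<^sup>2) + (\<Sum>i\<in>UNIV. (lam' t i)\<^sup>2))"
      using mult_left_mono[OF N6, of "c / 6"] c by simp
    also have "\<dots> \<le> Q t"
      unfolding Q_def distrib_left by (intro add_mono le sum_nonneg order_refl) auto
    finally show ?thesis using V'_le[OF t] by simp
  qed
  have "Liminf at_top (\<lambda>t. ereal (sqrt t * N t)) < \<infinity>"
    by (rule Liminf_sqrt_times_dissipation_finite[OF V_deriv V_nonneg diss]) (use c in auto)
  then show ?thesis by (simp only: N_def)
qed

end
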